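(* Let $\mathsf{H}$ be a quaternionic Hilbert space and let $T:D(T)\to\mathsf{H}$ be an operator with dense domain. The following assertions hold. (a) If $T\in\mathfrak{B}(\mathsf{H})$ is normal, then (i) $\sigma_{pS}(T)=\sigma_{pS}(T^* )$, (ii) $\sigma_{rS}(T)=\sigma_{rS}(T^* )=\emptyset$, (iii) $\sigma_{cS}(T)=\sigma_{cS}(T^* )$. (b) If $T$ is self-adjoint (not necessarily in $\mathfrak{B}(\mathsf{H})$), then $\sigma_S(T)\subset\mathbb{R}$ and $\sigma_{rS}(T)$ is empty. (c) If $T$ is anti self-adjoint (not necessarily in $\mathfrak{B}(\mathsf{H})$), then $\sigma_S(T)\subset\mathrm{Im}(\mathbb{H})$ and $\sigma_{rS}(T)$ is empty. (d) If $T\in\mathfrak{B}(\mathsf{H})$ is unitary, then $\sigma_S(T)\subset\{q\in\mathbb{H}:|q|=1\}$. (e) If $T\in\mathfrak{B}(\mathsf{H})$ is anti self-adjoint and unitary, then $\sigma_S(T)=\sigma_{pS}(T)=\mathbb{S}$.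
   Context: $\mathbb{H}$ denotes the quaternions, with conjugation $q\mapsto\overline q$ and norm $|q|=\sqrt{q\overline q}$; $\mathrm{Im}(\mathbb{H})=\{q:\overline q=-q\}$; $\mathbb{S}=\{q\in\mathbb{H}:q^2=-1\}$. A quaternionic Hilbert space $\mathsf{H}$ is a nonzero right $\mathbb{H}$-module with a scalar product $\langle\cdot|\cdot\rangle$ valued in $\mathbb{H}$, right $\mathbb{H}$-linear in the second argument, with $\langle u|v\rangle=\overline{\langle v|u\rangle}$, $\langle u|u\rangle\ge0$ (zero only for $u=0$), complete for $\|u\|=\sqrt{\langle u|u\rangle}$. An operator is a right $\mathbb{H}$-linear map $T:D(T)\to\mathsf{H}$ on a (not necessarily closed) right $\mathbb{H}$-linear subspace $D(T)$; $\mathfrak{B}(\mathsf{H})$ is the set of bounded operators with domain $\mathsf{H}$. If $D(T)$ is dense, the adjoint $T^*$ has domain $\{u:\exists w_u\ \langle w_u|v\rangle=\langle u|Tv\rangle\ \forall v\in D(T)\}$ and $T^*u=w_u$. Self-adjoint: $T=T^*$; anti self-adjoint: $T=-T^*$ (equality of domains included); normal: $T\in\mathfrak{B}(\mathsf{H})$, $TT^*=T^*T$; unitary: $D(T)=\mathsf{H}$, $TT^*=T^*T=\mathrm{I}$. For $q\in\mathbb{H}$ let $\Delta_q(T):D(T^2)\to\mathsf{H}$, $\Delta_q(T):=T^2-T(q+\overline q)+\mathrm{I}|q|^2$, where $(Tr)(u)=T(u)r$ for $r\in\mathbb{R}$ and $D(T^2)=\{u\in D(T):Tu\in D(T)\}$.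 The spherical resolvent set $\rho_S(T)$ is the set of $q\in\mathbb{H}$ such that $\mathrm{Ker}(\Delta_q(T))=\{0\}$, $\mathrm{Ran}(\Delta_q(T))$ is dense in $\mathsf{H}$, and $\Delta_q(T)^{-1}:\mathrm{Ran}(\Delta_q(T))\to D(T^2)$ is bounded. The spherical spectrum is $\sigma_S(T)=\mathbb{H}\setminus\rho_S(T)$; it is the disjoint union of the point spectrum $\sigma_{pS}(T)=\{q:\mathrm{Ker}(\Delta_q(T))\ne\{0\}\}$, the residual spectrum $\sigma_{rS}(T)=\{q:\mathrm{Ker}(\Delta_q(T))=\{0\},\ \overline{\mathrm{Ran}(\Delta_q(T))}\ne\mathsf{H}\}$, and the continuous spectrum $\sigma_{cS}(T)=\{q:\mathrm{Ker}(\Delta_q(T))=\{0\},\ \overline{\mathrm{Ran}(\Delta_q(T))}=\mathsf{H},\ \Delta_q(T)^{-1}\text{ not bounded}\}$. *)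

theory Defs
  imports "HOL-Analysis.Analysis"
begin

section \<open>Quaternions\<close>

datatype quat = Quat (qRe: real) (qIm1: real) (qIm2: real) (qIm3: real)

lemma quat_eq_iff:
  "p = q \<longleftrightarrow> qRe p = qRe q \<and> qIm1 p = qIm1 q \<and> qIm2 p = qIm2 q \<and> qIm3 p = qIm3 q"
  by (cases p; cases q) simp

instantiation quat :: ring_1
begin

definition "0 = Quat 0 0 0 0"
definition "1 = Quat 1 0 0 0"
definition "p + q = Quat (qRe p + qRe q) (qIm1 p + qIm1 q) (qIm2 p + qIm2 q) (qIm3 p + qIm3 q)"
definition "- q = Quat (- qRe q) (- qIm1 q) (- qIm2 q) (- qIm3 q)"
definition "p - q = Quat (qRe p - qRe q) (qIm1 p - qIm1 q) (qIm2 p - qIm2 q) (qIm3 p - qIm3 q)"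
definition "p * q = Quat
  (qRe p * qRe q - qIm1 p * qIm1 q - qIm2 p * qIm2 q - qIm3 p * qIm3 q)
  (qRe p * qIm1 q + qIm1 p * qRe q + qIm2 p * qIm3 q - qIm3 p * qIm2 q)
  (qRe p * qIm2 q - qIm1 p * qIm3 q + qIm2 p * qRe q + qIm3 p * qIm1 q)
  (qRe p * qIm3 q + qIm1 p * qIm2 q - qIm2 p * qIm1 q + qIm3 p * qRe q)"

lemmas quat_ring_defs =
  zero_quat_def one_quat_def plus_quat_def uminus_quat_def minus_quat_def times_quat_def

instance
proof
  fix a b c :: quat
  show "a * b * c = a * (b * c)"
    by (simp add: times_quat_def algebra_simps)
  show "(a + b) * c = a * c + b * c" "a * (b + c) = a * b + a * c"
    by (simp_all add: times_quat_def plus_quat_def algebra_simps)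
qed (simp_all add: quat_ring_defs quat_eq_iff)

end

instantiation quat :: real_vector
begin

definition "r *\<^sub>R q = Quat (r * qRe q) (r * qIm1 q) (r * qIm2 q) (r * qIm3 q)"

instance
  by standard (simp_all add: scaleR_quat_def quat_ring_defs quat_eq_iff algebra_simps)

end

instantiation quat :: real_inner
begin

definition "inner p q = qRe p * qRe q + qIm1 p * qIm1 q + qIm2 p * qIm2 q + qIm3 p * qIm3 q"
definition "norm q = sqrt ((qRe q)\<^sup>2 + (qIm1 q)\<^sup>2 + (qIm2 q)\<^sup>2 + (qIm3 q)\<^sup>2)"
definition "sgn (q :: quat) = q /\<^sub>R norm q"
definition "dist p q = norm (p - q :: quat)"
definition [code del]: "(uniformity :: (quat \<times> quat) filter) =
  (INF e\<in>{0 <..}. principal {(x, y). dist x y < e})"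
definition [code del]: "open (U :: quat set) \<longleftrightarrow>
  (\<forall>x\<in>U. eventually (\<lambda>(x', y). x' = x \<longrightarrow> y \<in> U) uniformity)"

instance
proof
  fix p :: quat
  show "0 \<le> inner p p"
    by (simp add: inner_quat_def)
  have "inner p p = (qRe p)\<^sup>2 + (qIm1 p)\<^sup>2 + (qIm2 p)\<^sup>2 + (qIm3 p)\<^sup>2"
    by (simp add: inner_quat_def power2_eq_square)
  then show "inner p p = 0 \<longleftrightarrow> p = 0"
    by (auto simp: zero_quat_def quat_eq_iff add_nonneg_eq_0_iff)
qed (simp_all add: scaleR_quat_def inner_quat_def norm_quat_def sgn_quat_def dist_quat_def
      uniformity_quat_def open_quat_def quat_ring_defs quat_eq_iff algebra_simps power2_eq_square)

end

instantiation quat :: real_normed_div_algebra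
begin

definition qcnj :: "quat \<Rightarrow> quat"
  where "qcnj q = Quat (qRe q) (- qIm1 q) (- qIm2 q) (- qIm3 q)"

definition "inverse q = qcnj q /\<^sub>R (norm q)\<^sup>2"
definition "p div q = p * inverse (q :: quat)"

lemma norm_quat_power2: "(norm q)\<^sup>2 = (qRe q)\<^sup>2 + (qIm1 q)\<^sup>2 + (qIm2 q)\<^sup>2 + (qIm3 q)\<^sup>2"
  by (simp add: norm_quat_def)

lemma quat_mult_qcnj: "q * qcnj q = (norm q)\<^sup>2 *\<^sub>R 1" "qcnj q * q = (norm q)\<^sup>2 *\<^sub>R 1"
  unfolding norm_quat_power2
  by (simp_all add: qcnj_def scaleR_quat_def quat_ring_defs quat_eq_iff power2_eq_square)

instance
proof
  fix p q :: quat and r :: real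
  show sc: "r *\<^sub>R p * q = r *\<^sub>R (p * q)" "p * r *\<^sub>R q = r *\<^sub>R (p * q)" for p q :: quat and r
    by (simp_all add: scaleR_quat_def quat_ring_defs quat_eq_iff algebra_simps)
  show "p div q = p * inverse q"
    by (rule divide_quat_def)
  show "inverse (0 :: quat) = 0"
    by (simp add: inverse_quat_def)
  show "p \<noteq> 0 \<Longrightarrow> inverse p * p = 1" "p \<noteq> 0 \<Longrightarrow> p * inverse p = 1"
    by (simp_all add: inverse_quat_def sc quat_mult_qcnj)
  have "(norm (p * q))\<^sup>2 = (norm p * norm q)\<^sup>2"
    unfolding norm_quat_power2 power_mult_distrib
    by (simp add: times_quat_def power2_eq_square algebra_simps)
  then show "norm (p * q) = norm p * norm q"
    by (simp add: power2_eq_iff_nonneg)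
qed

end

section \<open>Quaternionic Hilbert spaces\<close>

text \<open>Right \<open>\<H>\<close>-modules; the real scalar multiplication is the restriction of the quaternionic one.\<close>

class quat_module = ab_group_add + scaleR +
  fixes scaleQ :: "'a \<Rightarrow> quat \<Rightarrow> 'a"  (infixl \<open>*\<^sub>Q\<close> 75)
  assumes scaleQ_add_left: "(u + v) *\<^sub>Q q = u *\<^sub>Q q + v *\<^sub>Q q"
    and scaleQ_add_right: "u *\<^sub>Q (p + q) = u *\<^sub>Q p + u *\<^sub>Q q"
    and scaleQ_scaleQ: "u *\<^sub>Q p *\<^sub>Q q = u *\<^sub>Q (p * q)"
    and scaleQ_one: "u *\<^sub>Q 1 = u"
    and scaleR_scaleQ: "r *\<^sub>R u = u *\<^sub>Q of_real r"
begin

subclass real_vector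
proof
  fix u v :: 'a and r s :: real
  have "u *\<^sub>Q of_real s *\<^sub>Q of_real r = u *\<^sub>Q of_real (r * s)"
    by (simp only: scaleQ_scaleQ of_real_mult[symmetric] mult.commute)
  then show "r *\<^sub>R s *\<^sub>R u = (r * s) *\<^sub>R u"
    by (simp only: scaleR_scaleQ)
qed (simp_all add: scaleR_scaleQ scaleQ_add_left scaleQ_add_right scaleQ_one)

end

text \<open>Hermitian symmetry makes \<open>qinner u u\<close> real, so \<open>\<langle>u|u\<rangle> \<ge> 0\<close> is a condition on its real part.
  The norm, metric and topology are those determined by \<open>qinner\<close>. The laws of \<open>real_normed_vector\<close>
  follow from the remaining axioms (the triangle inequality by Cauchy--Schwarz); including the class
  only makes the library's notions of norm, closure and completeness available.\<close>

class quat_inner = quat_module + real_normed_vector +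
  fixes qinner :: "'a \<Rightarrow> 'a \<Rightarrow> quat"
  assumes qinner_add_right: "qinner u (v + w) = qinner u v + qinner u w"
    and qinner_scaleQ_right: "qinner u (v *\<^sub>Q q) = qinner u v * q"
    and qinner_commute: "qinner u v = qcnj (qinner v u)"
    and qinner_ge_zero: "0 \<le> qRe (qinner u u)"
    and qinner_eq_zero: "qinner u u = 0 \<Longrightarrow> u = 0"
    and norm_eq_sqrt_qinner: "norm u = sqrt (qRe (qinner u u))"

class quat_hilbert = quat_inner + complete_space +
  assumes nonzero_space: "\<exists>u. u \<noteq> 0"

section \<open>Operators\<close>

text \<open>An operator is a partial map \<open>T\<close> with domain \<open>D(T) = dom T\<close> and range \<open>ran T\<close>. Equality of
  partial maps includes equality of domains, and \<open>S \<circ>\<^sub>m T\<close> has the maximal domain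
  \<open>{u \<in> D(T). T u \<in> D(S)}\<close>.\<close>

definition qoperator :: "('a::quat_module \<rightharpoonup> 'a) \<Rightarrow> bool"
  where "qoperator T \<longleftrightarrow>
    T 0 = Some 0 \<and>
    (\<forall>u v u' v'. T u = Some u' \<and> T v = Some v' \<longrightarrow> T (u + v) = Some (u' + v')) \<and>
    (\<forall>u u' q. T u = Some u' \<longrightarrow> T (u *\<^sub>Q q) = Some (u' *\<^sub>Q q))"

definition qbounded :: "('a::quat_inner \<rightharpoonup> 'a) \<Rightarrow> bool"
  where "qbounded T \<longleftrightarrow> (\<exists>C. \<forall>u v. T u = Some v \<longrightarrow> norm v \<le> C * norm u)"

definition bounded_operators :: "('a::quat_inner \<rightharpoonup> 'a) set"  (\<open>\<BB>\<close>)
  where "\<BB> = {T. qoperator T \<and> dom T = UNIV \<and> qbounded T}"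

text \<open>Meaningful for densely defined \<open>T\<close>, where the vector \<open>w\<close> is unique.\<close>

definition adjoint_op :: "('a::quat_inner \<rightharpoonup> 'a) \<Rightarrow> ('a \<rightharpoonup> 'a)"
  where "adjoint_op T u =
    (if \<exists>w. \<forall>v\<in>dom T. qinner w v = qinner u (the (T v))
     then Some (THE w. \<forall>v\<in>dom T. qinner w v = qinner u (the (T v)))
     else None)"

definition uminus_op :: "('a::quat_module \<rightharpoonup> 'a) \<Rightarrow> ('a \<rightharpoonup> 'a)"
  where "uminus_op T u = map_option uminus (T u)"

definition self_adjoint :: "('a::quat_inner \<rightharpoonup> 'a) \<Rightarrow> bool"
  where "self_adjoint T \<longleftrightarrow> T = adjoint_op T"

definition anti_self_adjoint :: "('a::quat_inner \<rightharpoonup> 'a) \<Rightarrow> bool"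
  where "anti_self_adjoint T \<longleftrightarrow> T = uminus_op (adjoint_op T)"

definition normal_op :: "('a::quat_inner \<rightharpoonup> 'a) \<Rightarrow> bool"
  where "normal_op T \<longleftrightarrow> T \<in> \<BB> \<and> T \<circ>\<^sub>m adjoint_op T = adjoint_op T \<circ>\<^sub>m T"

text \<open>The identity operator is the total map \<open>Some\<close>.\<close>

definition unitary_op :: "('a::quat_inner \<rightharpoonup> 'a) \<Rightarrow> bool"
  where "unitary_op T \<longleftrightarrow>
    dom T = UNIV \<and> T \<circ>\<^sub>m adjoint_op T = Some \<and> adjoint_op T \<circ>\<^sub>m T = Some"

definition kernel :: "('a::quat_module \<rightharpoonup> 'a) \<Rightarrow> 'a set"
  where "kernel T = {u. T u = Some 0}"

text \<open>For injective \<open>T\<close>, the inverse \<open>T\<^sup>-\<^sup>1 : Ran(T) \<rightarrow> D(T)\<close>.\<close>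

definition inverse_op :: "('a \<rightharpoonup> 'a) \<Rightarrow> ('a \<rightharpoonup> 'a)"
  where "inverse_op T v = (if v \<in> ran T then Some (THE u. T u = Some v) else None)"

section \<open>Spherical spectrum\<close>

definition Delta_op :: "quat \<Rightarrow> ('a::quat_module \<rightharpoonup> 'a) \<Rightarrow> ('a \<rightharpoonup> 'a)"
  where "Delta_op q T u =
    (if u \<in> dom (T \<circ>\<^sub>m T)
     then Some (the ((T \<circ>\<^sub>m T) u) - the (T u) *\<^sub>Q (q + qcnj q) + u *\<^sub>Q of_real ((norm q)\<^sup>2))
     else None)"

definition spherical_resolvent_set :: "('a::quat_inner \<rightharpoonup> 'a) \<Rightarrow> quat set"
  where "spherical_resolvent_set T = {q.
    kernel (Delta_op q T) = {0} \<and>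
    closure (ran (Delta_op q T)) = UNIV \<and>
    qbounded (inverse_op (Delta_op q T))}"

definition spherical_spectrum :: "('a::quat_inner \<rightharpoonup> 'a) \<Rightarrow> quat set"
  where "spherical_spectrum T = - spherical_resolvent_set T"

definition spherical_point_spectrum :: "('a::quat_inner \<rightharpoonup> 'a) \<Rightarrow> quat set"
  where "spherical_point_spectrum T = {q. kernel (Delta_op q T) \<noteq> {0}}"

definition spherical_residual_spectrum :: "('a::quat_inner \<rightharpoonup> 'a) \<Rightarrow> quat set"
  where "spherical_residual_spectrum T = {q.
    kernel (Delta_op q T) = {0} \<and>
    closure (ran (Delta_op q T)) \<noteq> UNIV}"

definition spherical_continuous_spectrum :: "('a::quat_inner \<rightharpoonup> 'a) \<Rightarrow> quat set"
  where "spherical_continuous_spectrum T = {q.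
    kernel (Delta_op q T) = {0} \<and>
    closure (ran (Delta_op q T)) = UNIV \<and>
    \<not> qbounded (inverse_op (Delta_op q T))}"

end

theory Submission
  imports Defs
begin

text \<open>Almost everything is read off the real scalar product \<open>Re \<langle>u|v\<rangle>\<close>.
  With the real linear maps \<open>R\<^sub>p u = T u - u p\<close> one has \<open>\<Delta>\<^sub>q(T) = R\<^sub>q R\<^sub>p\<close> for \<open>p = qcnj q\<close>,
  so a lower bound for \<open>R\<^sub>q\<close> and \<open>R\<^sub>p\<close> makes \<open>\<Delta>\<^sub>q(T)\<close> injective with bounded inverse; such bounds hold
  with constant \<open>|Im q|\<close>, \<open>|Re q|\<close> and \<open>|1 - |q||\<close> in the self-adjoint, anti self-adjoint and
  unitary case. It remains to see that the residual spectrum is empty. For bounded normal \<open>T\<close> this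
  follows from \<open>\<parallel>\<Delta>\<^sub>q(T) u\<parallel> = \<parallel>\<Delta>\<^sub>q(T\<^sup>*) u\<parallel>\<close>. For unbounded \<open>T = \<plusminus>T\<^sup>*\<close>, a vector \<open>w\<close> orthogonal to
  the range of \<open>\<Delta>\<^sub>q(T)\<close> is first regularised to \<open>z = (I + T\<^sup>* T)\<^sup>-\<^sup>1 w\<close>, which is still orthogonal to
  the range but lies in \<open>D(T\<^sup>2)\<close>; then \<open>\<parallel>\<Delta>\<^sub>q(T) z\<parallel> = \<parallel>\<Delta>\<^sub>q(T\<^sup>*) z\<parallel> = 0\<close>.\<close>

section \<open>Quaternion arithmetic in coordinates\<close>

lemma quat_sel_simps [simp]:
  "qRe (p + q) = qRe p + qRe q" "qIm1 (p + q) = qIm1 p + qIm1 q"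
  "qIm2 (p + q) = qIm2 p + qIm2 q" "qIm3 (p + q) = qIm3 p + qIm3 q"
  "qRe (p - q) = qRe p - qRe q" "qIm1 (p - q) = qIm1 p - qIm1 q"
  "qIm2 (p - q) = qIm2 p - qIm2 q" "qIm3 (p - q) = qIm3 p - qIm3 q"
  "qRe (- q) = - qRe q" "qIm1 (- q) = - qIm1 q" "qIm2 (- q) = - qIm2 q" "qIm3 (- q) = - qIm3 q"
  "qRe 0 = 0" "qIm1 0 = 0" "qIm2 0 = 0" "qIm3 0 = 0"
  "qRe 1 = 1" "qIm1 1 = 0" "qIm2 1 = 0" "qIm3 1 = 0"
  "qRe (r *\<^sub>R q) = r * qRe q" "qIm1 (r *\<^sub>R q) = r * qIm1 q"
  "qIm2 (r *\<^sub>R q) = r * qIm2 q" "qIm3 (r *\<^sub>R q) = r * qIm3 q"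
  "qRe (of_real r) = r" "qIm1 (of_real r) = 0" "qIm2 (of_real r) = 0" "qIm3 (of_real r) = 0"
  "qRe (qcnj q) = qRe q" "qIm1 (qcnj q) = - qIm1 q"
  "qIm2 (qcnj q) = - qIm2 q" "qIm3 (qcnj q) = - qIm3 q"
  by (simp_all add: quat_ring_defs scaleR_quat_def of_real_def qcnj_def)

lemma quat_mult_sel:
  "qRe (p * q) = qRe p * qRe q - qIm1 p * qIm1 q - qIm2 p * qIm2 q - qIm3 p * qIm3 q"
  "qIm1 (p * q) = qRe p * qIm1 q + qIm1 p * qRe q + qIm2 p * qIm3 q - qIm3 p * qIm2 q"
  "qIm2 (p * q) = qRe p * qIm2 q - qIm1 p * qIm3 q + qIm2 p * qRe q + qIm3 p * qIm1 q"
  "qIm3 (p * q) = qRe p * qIm3 q + qIm1 p * qIm2 q - qIm2 p * qIm1 q + qIm3 p * qRe q"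
  by (simp_all add: times_quat_def)

lemma qcnj_qcnj [simp]: "qcnj (qcnj q) = q"
  by (simp add: quat_eq_iff)

lemma qcnj_mult: "qcnj (p * q) = qcnj q * qcnj p"
  by (simp add: quat_eq_iff quat_mult_sel)

lemma quat_add_qcnj: "q + qcnj q = of_real (2 * qRe q)"
  by (simp add: quat_eq_iff del: of_real_mult)

lemma norm_qcnj [simp]: "norm (qcnj q) = norm q"
  by (simp add: norm_quat_def)

lemma qRe_mult_commute: "qRe (p * q) = qRe (q * p)"
  by (simp add: quat_mult_sel)

text \<open>Testing against 1, i, j, k recovers the four coordinates up to sign.\<close>

lemma quat_eqI_qRe_mult:
  assumes "\<And>q. qRe (p * q) = qRe (p' * q)"
  shows "p = p'"
  using assms[of 1] assms[of "Quat 0 1 0 0"] assms[of "Quat 0 0 1 0"] assms[of "Quat 0 0 0 1"]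
  by (simp add: quat_eq_iff quat_mult_sel)

text \<open>Norms give |q| = 1. The imaginary part of the square is 2 Re q Im q, so a nonzero real
  part would force q to be real, with a negative square.\<close>

lemma quat_power2_eq_minus_one_iff: "q\<^sup>2 = - 1 \<longleftrightarrow> qRe q = 0 \<and> norm (q :: quat) = 1"
proof
  assume q: "q\<^sup>2 = - 1"
  have "(norm q)\<^sup>2 = 1"
    using arg_cong[OF q, of norm] by (simp add: norm_power)
  moreover have "qRe q = 0"
  proof (rule ccontr)
    assume "qRe q \<noteq> 0"
    with q have "qIm1 q = 0" "qIm2 q = 0" "qIm3 q = 0"
      by (auto simp: power2_eq_square quat_eq_iff quat_mult_sel)
    moreover have "qRe (q\<^sup>2) = - 1"
      using q by simp
    ultimately have "qRe q * qRe q = -1"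
      by (simp add: power2_eq_square quat_mult_sel)
    then show False
      using zero_le_square[of "qRe q"] by linarith
  qed
  ultimately show "qRe q = 0 \<and> norm q = 1"
    by (simp add: power2_eq_1_iff)  (metis norm_ge_zero neg_0_le_iff_le not_one_le_zero)
next
  assume q: "qRe q = 0 \<and> norm q = 1"
  then have "(qIm1 q)\<^sup>2 + (qIm2 q)\<^sup>2 + (qIm3 q)\<^sup>2 = 1"
    using norm_quat_power2[of q] by simp
  with q show "q\<^sup>2 = - 1"
    by (simp add: power2_eq_square quat_eq_iff quat_mult_sel)
qed

section \<open>The real scalar product\<close>


text \<open>The real part induces the same norm, and its values at all \<open>v *\<^sub>Q q\<close>
  determine the quaternionic product; see \<open>qinner_eqI_rinner\<close>.\<close>

definition rinner :: "'a::quat_inner \<Rightarrow> 'a \<Rightarrow> real"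
  where "rinner u v = qRe (qinner u v)"

lemma rinner_commute: "rinner u v = rinner v u"
  unfolding rinner_def by (subst qinner_commute) simp

lemma rinner_add_right: "rinner u (v + w) = rinner u v + rinner u w"
  by (simp add: rinner_def qinner_add_right)

text \<open>The two factors of a product can be exchanged under the real part, so right
  multiplications by q and by \<open>qcnj q\<close> are adjoint to each other.\<close>

lemma rinner_scaleQ_right: "rinner u (v *\<^sub>Q q) = rinner (u *\<^sub>Q qcnj q) v"
proof -
  have "rinner (u *\<^sub>Q qcnj q) v = qRe (qcnj (qinner v u * qcnj q))"
    unfolding rinner_def by (subst qinner_commute) (simp add: qinner_scaleQ_right)
  also have "\<dots> = qRe (q * qcnj (qinner v u))"
    by (simp add: qcnj_mult)
  also have "\<dots> = rinner u (v *\<^sub>Q q)"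
    by (simp add: rinner_def qinner_scaleQ_right qRe_mult_commute[of q] flip: qinner_commute)
  finally show ?thesis ..
qed

lemma rinner_scaleR_right: "rinner u (r *\<^sub>R v) = r * rinner u v"
  by (simp add: rinner_def scaleR_scaleQ qinner_scaleQ_right quat_mult_sel)

lemma bilinear_rinner: "bilinear rinner"
proof -
  have "linear (rinner u)" for u :: 'a
    by (simp add: linear_iff rinner_add_right rinner_scaleR_right)
  moreover have "(\<lambda>x. rinner x u) = rinner u" for u :: 'a
    by (simp add: fun_eq_iff rinner_commute)
  ultimately show ?thesis
    by (simp add: bilinear_def)
qed

lemmas rinner_simps =
  bilinear_ladd[OF bilinear_rinner] bilinear_radd[OF bilinear_rinner]
  bilinear_lsub[OF bilinear_rinner] bilinear_rsub[OF bilinear_rinner]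
  bilinear_lmul[OF bilinear_rinner] bilinear_rmul[OF bilinear_rinner]
  bilinear_lneg[OF bilinear_rinner] bilinear_rneg[OF bilinear_rinner]
  bilinear_lzero[OF bilinear_rinner] bilinear_rzero[OF bilinear_rinner]

lemma rinner_same: "rinner u u = (norm u)\<^sup>2"
  by (simp add: norm_eq_sqrt_qinner rinner_def qinner_ge_zero)

lemma norm_scaleQ: "norm (u *\<^sub>Q q) = norm (u::'a::quat_inner) * norm q"
proof -
  have "(norm (u *\<^sub>Q q))\<^sup>2 = rinner (u *\<^sub>Q (q * qcnj q)) u"
    by (simp add: scaleQ_scaleQ rinner_scaleQ_right flip: rinner_same)
  also have "\<dots> = rinner ((norm q)\<^sup>2 *\<^sub>R u) u"
    by (simp add: quat_mult_qcnj scaleR_scaleQ of_real_def)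
  also have "\<dots> = (norm u * norm q)\<^sup>2"
    by (simp only: rinner_simps rinner_same power_mult_distrib real_scaleR_def mult.commute)
  finally show ?thesis
    by (simp add: power2_eq_iff_nonneg)
qed

text \<open>The triangle inequality belongs to the class; squaring it for v and for -v gives both
  signs.\<close>

lemma rinner_cauchy_schwarz: "\<bar>rinner u v\<bar> \<le> norm u * norm v"
proof -
  have "rinner u v \<le> norm u * norm v" for u v :: 'a
  proof -
    have "(norm (u + v))\<^sup>2 \<le> (norm u + norm v)\<^sup>2"
      by (intro power_mono norm_triangle_ineq) simp
    then show ?thesis
      by (simp add: rinner_simps rinner_commute[of v u] power2_sum flip: rinner_same)
  qed
  from this[of u v] this[of u "- v"] show ?thesis
    by (simp add: rinner_simps abs_le_iff)
qed

lemma bounded_bilinear_rinner: "bounded_bilinear rinner"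
proof
  show "\<exists>K. \<forall>a b. norm (rinner a b) \<le> norm a * norm b * K"
    by (intro exI[of _ 1]) (simp add: rinner_cauchy_schwarz)
qed (simp_all add: rinner_simps)

lemmas continuous_on_rinner [continuous_intros] = bounded_bilinear.continuous_on[OF bounded_bilinear_rinner]

lemma qinner_eqI_rinner:
  assumes "\<And>q. rinner u (v *\<^sub>Q q) = rinner u' (v' *\<^sub>Q q)"
  shows "qinner u v = qinner u' v'"
  using assms by (intro quat_eqI_qRe_mult) (simp add: rinner_def qinner_scaleQ_right)

section \<open>Orthogonal projections\<close>

text \<open>A minimising sequence for the distance from x to M converges to the projection. The form
  B is arbitrary so that the result serves both \<open>rinner\<close> and the product form on pairs,
  which is needed for graphs.\<close>

lemma orthogonal_projection_exists:
  fixes B :: "'a::{real_normed_vector,complete_space} \<Rightarrow> 'a \<Rightarrow> real"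
  assumes B: "bilinear B" and sym: "\<And>x y. B x y = B y x" and nrm: "\<And>x. B x x = (norm x)\<^sup>2"
    and M: "subspace M" "closed M"
  obtains m where "m \<in> M" "\<And>v. v \<in> M \<Longrightarrow> B (x - m) v = 0"
proof -
  note B_simps = bilinear_ladd[OF B] bilinear_radd[OF B] bilinear_lsub[OF B] bilinear_rsub[OF B]
    bilinear_lmul[OF B] bilinear_rmul[OF B]
  have expand: "(norm (y - t *\<^sub>R v))\<^sup>2 = (norm y)\<^sup>2 - 2 * t * B y v + t\<^sup>2 * (norm v)\<^sup>2" for y v t
    by (simp add: B_simps sym[of v y] power2_eq_square[of t] algebra_simps flip: nrm)
  define d where "d = (INF m\<in>M. (norm (x - m))\<^sup>2)"
  have ne: "M \<noteq> {}"
    using subspace_0[OF M(1)] by auto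
  have bdd: "bdd_below ((\<lambda>m. (norm (x - m))\<^sup>2) ` M)"
    by (intro bdd_belowI[of _ 0]) auto
  have d_le: "d \<le> (norm (x - m))\<^sup>2" if "m \<in> M" for m
    unfolding d_def using bdd that by (rule cINF_lower)
  have "\<exists>m\<in>M. (norm (x - m))\<^sup>2 < d + inverse (real (Suc n))" for n
  proof -
    have "(INF m\<in>M. (norm (x - m))\<^sup>2) < d + inverse (real (Suc n))"
      unfolding d_def[symmetric] by simp
    then show ?thesis
      by (subst (asm) cINF_less_iff[OF ne bdd])
  qed
  then obtain f where f: "\<And>n. f n \<in> M" "\<And>n. (norm (x - f n))\<^sup>2 < d + inverse (real (Suc n))"
    by metis
  \<comment> \<open>Parallelogram law; the midpoint of m and m' lies in M, so its squared distance
    to x is at least d.\<close>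
  have dist_le: "(norm (m - m'))\<^sup>2 \<le> 2 * ((norm (x - m))\<^sup>2 - d) + 2 * ((norm (x - m'))\<^sup>2 - d)"
    if "m \<in> M" "m' \<in> M" for m m'
  proof -
    have "(1/2) *\<^sub>R (m + m') \<in> M"
      using M(1) that by (simp add: subspace_add subspace_scale)
    from d_le[OF this] have "d \<le> (norm (x - (1/2) *\<^sub>R (m + m')))\<^sup>2" .
    moreover have "(norm (m - m'))\<^sup>2 + 4 * (norm (x - (1/2) *\<^sub>R (m + m')))\<^sup>2 =
        2 * (norm (x - m))\<^sup>2 + 2 * (norm (x - m'))\<^sup>2"
      by (simp add: B_simps sym[of m x] sym[of m' x] sym[of m' m] algebra_simps flip: nrm)
    ultimately show ?thesis
      by simp
  qed
  have "Cauchy f"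
  proof (rule metric_CauchyI)
    fix e :: real assume "0 < e"
    then obtain N where N: "inverse (real (Suc N)) < e\<^sup>2 / 4"
      using reals_Archimedean[of "e\<^sup>2 / 4"] by auto
    have "dist (f m) (f n) < e" if "N \<le> m" "N \<le> n" for m n
    proof -
      have "inverse (real (Suc m)) \<le> inverse (real (Suc N))"
        "inverse (real (Suc n)) \<le> inverse (real (Suc N))"
        using that by (simp_all add: le_imp_inverse_le)
      then have "(norm (x - f m))\<^sup>2 < d + e\<^sup>2 / 4" "(norm (x - f n))\<^sup>2 < d + e\<^sup>2 / 4"
        using f(2)[of m] f(2)[of n] N by linarith+
      then have "(norm (f m - f n))\<^sup>2 < e\<^sup>2"
        using dist_le[OF f(1)[of m] f(1)[of n]] by argo
      then show ?thesis
        using \<open>0 < e\<close> by (simp add: dist_norm power_less_imp_less_base)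
    qed
    then show "\<exists>N. \<forall>m\<ge>N. \<forall>n\<ge>N. dist (f m) (f n) < e"
      by blast
  qed
  then obtain m where m: "f \<longlonglongrightarrow> m"
    using Cauchy_convergent convergent_def by blast
  have "m \<in> M"
    using M(2) f(1) m by (auto simp: closed_sequential_limits)
  have "(\<lambda>n. d + inverse (real (Suc n))) \<longlonglongrightarrow> d + 0"
    by (intro tendsto_intros LIMSEQ_inverse_real_of_nat)
  moreover have "(\<lambda>n. (norm (x - f n))\<^sup>2) \<longlonglongrightarrow> (norm (x - m))\<^sup>2"
    by (intro tendsto_intros m)
  ultimately have m_le: "(norm (x - m))\<^sup>2 \<le> d"
    using f(2) by (intro LIMSEQ_le[where Y = "\<lambda>n. d + inverse (real (Suc n))"]) (auto intro: less_imp_le)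
  have "B (x - m) v = 0" if "v \<in> M" for v
  proof (cases "v = 0")
    case True
    then show ?thesis using bilinear_rzero[OF B] by simp
  next
    case False
    \<comment> \<open>This t minimises the quadratic \<open>expand\<close> with \<open>x - m\<close>
      for y.\<close>
    define t where "t = B (x - m) v / (norm v)\<^sup>2"
    have "m + t *\<^sub>R v \<in> M"
      using M(1) \<open>m \<in> M\<close> that by (simp add: subspace_add subspace_scale)
    from d_le[OF this] m_le have "(norm (x - m))\<^sup>2 \<le> (norm ((x - m) - t *\<^sub>R v))\<^sup>2"
      by (simp only: diff_diff_eq)
    also have "\<dots> = (norm (x - m))\<^sup>2 - 2 * t * B (x - m) v + t\<^sup>2 * (norm v)\<^sup>2"
      by (rule expand)
    also have "\<dots> = (norm (x - m))\<^sup>2 - (B (x - m) v)\<^sup>2 / (norm v)\<^sup>2"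
      using False by (simp add: t_def power2_eq_square)
    finally have "(B (x - m) v)\<^sup>2 / (norm v)\<^sup>2 \<le> 0"
      by simp
    then show ?thesis
      using False by (simp add: divide_le_0_iff)
  qed
  with \<open>m \<in> M\<close> show ?thesis
    by (rule that)
qed

lemma subspace_closure:
  fixes M :: "'a::real_normed_vector set"
  assumes M: "subspace M"
  shows "subspace (closure M)"
proof (rule subspaceI)
  show "0 \<in> closure M"
    using closure_subset subspace_0[OF M] by blast
  show "x + y \<in> closure M" if xy: "x \<in> closure M" "y \<in> closure M" for x y
  proof -
    obtain f g where fg: "\<forall>n. f n \<in> M" "f \<longlonglongrightarrow> x" "\<forall>n. g n \<in> M" "g \<longlonglongrightarrow> y"
      using xy unfolding closure_sequential by blast
    then show ?thesis
      unfolding closure_sequential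
      by (intro exI[of _ "\<lambda>n. f n + g n"]) (auto intro: tendsto_add subspace_add[OF M])
  qed
  show "c *\<^sub>R x \<in> closure M" if x: "x \<in> closure M" for c x
  proof -
    obtain f where f: "\<forall>n. f n \<in> M" "f \<longlonglongrightarrow> x"
      using x unfolding closure_sequential by blast
    then show ?thesis
      unfolding closure_sequential
      by (intro exI[of _ "\<lambda>n. c *\<^sub>R f n"]) (auto intro: tendsto_intros subspace_scale[OF M])
  qed
qed

text \<open>If m is the projection of x onto the closure, then \<open>x - m\<close> is orthogonal to
  M, hence zero.\<close>

lemma dense_subspaceI:
  fixes M :: "'a::quat_hilbert set"
  assumes M: "subspace M" and orth: "\<And>w. (\<And>v. v \<in> M \<Longrightarrow> rinner w v = 0) \<Longrightarrow> w = 0"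
  shows "closure M = UNIV"
proof -
  have "x \<in> closure M" for x
  proof -
    obtain m where m: "m \<in> closure M" "\<And>v. v \<in> closure M \<Longrightarrow> rinner (x - m) v = 0"
      using orthogonal_projection_exists[OF bilinear_rinner rinner_commute rinner_same
          subspace_closure[OF M] closed_closure] by blast
    then have "x - m = 0"
      using closure_subset by (intro orth) blast
    with m(1) show ?thesis by simp
  qed
  then show ?thesis by blast
qed

lemma rinner_dense_eq_zero:
  fixes M :: "'a::quat_inner set"
  assumes "closure M = UNIV" "\<And>v. v \<in> M \<Longrightarrow> rinner w v = 0"
  shows "w = 0"
proof -
  have "rinner w w = 0"
    by (rule continuous_constant_on_closure[of M "rinner w"])
      (use assms in \<open>auto intro!: continuous_intros\<close>)
  then show ?thesis by (simp add: rinner_same)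
qed

text \<open>The kernel of f is closed. A vector z orthogonal to it, suitably scaled, represents f,
  because v - (f v / f z) z lies in the kernel.\<close>

lemma riesz_representation:
  fixes f :: "'a::quat_hilbert \<Rightarrow> real"
  assumes f: "bounded_linear f"
  obtains w where "\<And>v. f v = rinner w v"
proof (cases "\<forall>v. f v = 0")
  case True
  then show ?thesis by (intro that[of 0]) (simp add: rinner_simps)
next
  case False
  then obtain h where h: "f h \<noteq> 0" by blast
  interpret bounded_linear f by fact
  let ?M = "{v. f v = 0}"
  have M: "subspace ?M" "closed ?M"
    by (auto simp: subspace_def add scaleR zero intro!: closed_Collect_eq continuous_intros continuous_on)
  obtain m where m: "f m = 0" "\<And>v. f v = 0 \<Longrightarrow> rinner (h - m) v = 0"
    using orthogonal_projection_exists[OF bilinear_rinner rinner_commute rinner_same M, of h] by auto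
  define z where "z = h - m"
  have fz: "f z = f h" and "z \<noteq> 0"
    using h m(1) by (auto simp: z_def diff)
  have "f v = rinner ((f z / (norm z)\<^sup>2) *\<^sub>R z) v" for v
  proof -
    have "rinner z (v - (f v / f z) *\<^sub>R z) = 0"
      unfolding z_def using h fz by (intro m(2)) (simp add: diff scaleR z_def)
    then have "rinner z v = f v / f z * (norm z)\<^sup>2"
      by (simp add: rinner_simps rinner_same)
    with h fz \<open>z \<noteq> 0\<close> show ?thesis
      by (simp add: rinner_simps)
  qed
  then show ?thesis by (rule that)
qed

section \<open>Operators and adjoints\<close>

lemma qoperatorD:
  assumes "qoperator T"
  shows "T 0 = Some 0"
    and "T u = Some u' \<Longrightarrow> T v = Some v' \<Longrightarrow> T (u + v) = Some (u' + v')"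
    and "T u = Some u' \<Longrightarrow> T v = Some v' \<Longrightarrow> T (u - v) = Some (u' - v')"
    and "T u = Some u' \<Longrightarrow> T (u *\<^sub>Q q) = Some (u' *\<^sub>Q q)"
    and "T u = Some u' \<Longrightarrow> T (r *\<^sub>R u) = Some (r *\<^sub>R u')"
proof -
  show "T 0 = Some 0"
    and add: "T u = Some u' \<Longrightarrow> T v = Some v' \<Longrightarrow> T (u + v) = Some (u' + v')"
    and Q: "T u = Some u' \<Longrightarrow> T (u *\<^sub>Q q) = Some (u' *\<^sub>Q q)" for u u' v v' q
    using assms by (auto simp: qoperator_def)
  show R: "T u = Some u' \<Longrightarrow> T (r *\<^sub>R u) = Some (r *\<^sub>R u')" for u u' r
    by (simp add: scaleR_scaleQ Q)
  show "T u = Some u' \<Longrightarrow> T v = Some v' \<Longrightarrow> T (u - v) = Some (u' - v')"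
    using add[of u u' "(-1) *\<^sub>R v" "(-1) *\<^sub>R v'"] R[of v v' "-1"] by simp
qed

lemma subspace_ran:
  assumes "qoperator T"
  shows "subspace (ran T)"
proof (rule subspaceI)
  show "0 \<in> ran T"
    using qoperatorD(1)[OF assms] by (rule ranI)
  show "x + y \<in> ran T" if "x \<in> ran T" "y \<in> ran T" for x y
    using that qoperatorD(2)[OF assms] unfolding ran_def by blast
  show "c *\<^sub>R x \<in> ran T" if "x \<in> ran T" for c x
    using that qoperatorD(5)[OF assms] unfolding ran_def by blast
qed

text \<open>Replaces the description operator and the quaternionic equation by a real one. The
  domain is stable under right multiplication, so the real equations at all
  \<open>v *\<^sub>Q q\<close> give the quaternionic one; density makes w unique.\<close>

lemma adjoint_op_eq_Some_iff:
  fixes T :: "'a::quat_inner \<rightharpoonup> 'a"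
  assumes T: "qoperator T" and dense: "closure (dom T) = UNIV"
  shows "adjoint_op T u = Some w \<longleftrightarrow> (\<forall>v v'. T v = Some v' \<longrightarrow> rinner w v = rinner u v')"
proof -
  have iff: "(\<forall>v\<in>dom T. qinner w v = qinner u (the (T v))) \<longleftrightarrow>
      (\<forall>v v'. T v = Some v' \<longrightarrow> rinner w v = rinner u v')" (is "?L w \<longleftrightarrow> ?R w") for w
  proof
    assume R: "?R w"
    show "?L w"
    proof
      fix v assume "v \<in> dom T"
      then obtain v' where v': "T v = Some v'" by auto
      have "rinner w (v *\<^sub>Q q) = rinner u (v' *\<^sub>Q q)" for q
        using R qoperatorD(4)[OF T v'] by blast
      then show "qinner w v = qinner u (the (T v))"
        unfolding v' option.sel by (rule qinner_eqI_rinner)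
    qed
  next
    assume L: "?L w"
    have "rinner w v = rinner u v'" if "T v = Some v'" for v v'
      unfolding rinner_def using bspec[OF L domI[of T v v', OF that]] that by simp
    then show "?R w" by blast
  qed
  have unique: "w = w'" if "?R w" "?R w'" for w w'
  proof -
    have "w - w' = 0"
      using dense by (rule rinner_dense_eq_zero) (use that in \<open>auto simp: rinner_simps\<close>)
    then show ?thesis by simp
  qed
  show ?thesis
  proof (cases "\<exists>w. ?R w")
    case True
    then obtain w0 where w0: "?R w0" by blast
    have "(THE w. ?R w) = w0"
      by (rule the_equality) (use w0 unique in blast)+
    with True have "adjoint_op T u = Some w0"
      unfolding adjoint_op_def iff by (simp only: if_True)
    then show ?thesis
      using w0 unique by (auto simp only: option.inject)
  next
    case False
    then show ?thesis
      unfolding adjoint_op_def iff by (simp only: if_False) blast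
  qed
qed

lemma qoperator_adjoint_op:
  fixes T :: "'a::quat_inner \<rightharpoonup> 'a"
  assumes T: "qoperator T" "closure (dom T) = UNIV"
  shows "qoperator (adjoint_op T)"
  unfolding qoperator_def adjoint_op_eq_Some_iff[OF T]
proof (intro conjI allI impI, goal_cases)
  case (3 u u' q v v')
  then have "rinner u' (v *\<^sub>Q qcnj q) = rinner u (v' *\<^sub>Q qcnj q)"
    using qoperatorD(4)[OF T(1)] by blast
  then show ?case
    by (simp add: rinner_scaleQ_right)
qed (auto simp: rinner_simps)

text \<open>Riesz representation of the bounded functional v \<mapsto> Re \<langle>u|T
  v\<rangle>.\<close>

lemma adjoint_op_total:
  fixes T :: "'a::quat_hilbert \<rightharpoonup> 'a"
  assumes "T \<in> \<BB>"
  shows "dom (adjoint_op T) = UNIV"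
proof -
  have T: "qoperator T" "dom T = UNIV" and "qbounded T"
    using assms by (auto simp: bounded_operators_def)
  then obtain C where C: "\<And>u v. T u = Some v \<Longrightarrow> norm v \<le> C * norm u"
    by (auto simp: qbounded_def)
  have T_eq: "T v = Some (the (T v))" for v
    using T(2) domD[of v T] by auto
  have "\<exists>w. adjoint_op T u = Some w" for u
  proof -
    have "bounded_linear (\<lambda>v. rinner u (the (T v)))"
    proof (rule bounded_linear_intro)
      show "rinner u (the (T (v + v'))) = rinner u (the (T v)) + rinner u (the (T v'))" for v v'
        using qoperatorD(2)[OF T(1) T_eq T_eq, of v v'] by (simp add: rinner_simps)
      show "rinner u (the (T (r *\<^sub>R v))) = r *\<^sub>R rinner u (the (T v))" for r v
        using qoperatorD(5)[OF T(1) T_eq, of r v] by (simp add: rinner_simps)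
      show "norm (rinner u (the (T v))) \<le> norm v * (norm u * C)" for v
        using rinner_cauchy_schwarz[of u "the (T v)"] mult_left_mono[OF C[OF T_eq[of v]], of "norm u"]
        by (simp add: mult_ac)
    qed
    then obtain w where "\<And>v. rinner u (the (T v)) = rinner w v"
      using riesz_representation[of "\<lambda>v. rinner u (the (T v))"] by blast
    then have "adjoint_op T u = Some w"
      using T by (subst adjoint_op_eq_Some_iff) (auto, metis option.sel)
    then show ?thesis ..
  qed
  then show ?thesis by auto
qed

section \<open>The operator \<open>\<Delta>\<^sub>q(T)\<close> and lower bounds for it\<close>

lemma Delta_op_eq_Some_iff:
  "Delta_op q T u = Some w \<longleftrightarrow> (\<exists>u' u''. T u = Some u' \<and> T u' = Some u'' \<and>
    w = u'' - (2 * qRe q) *\<^sub>R u' + (norm q)\<^sup>2 *\<^sub>R u)"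
  by (auto simp: Delta_op_def map_comp_def dom_def quat_add_qcnj scaleR_scaleQ simp del: of_real_mult
      split: option.splits)

lemma qoperator_Delta_op:
  fixes T :: "'a::quat_inner \<rightharpoonup> 'a"
  assumes T: "qoperator T"
  shows "qoperator (Delta_op q T)"
proof -
  note T_simps = qoperatorD[OF T]
  have R: "(r *\<^sub>R u) *\<^sub>Q p = r *\<^sub>R (u *\<^sub>Q p)" for r p and u :: 'a
    by (simp add: scaleR_scaleQ scaleQ_scaleQ Reals_def of_real_def)
  have D: "(u - v) *\<^sub>Q p = u *\<^sub>Q p - v *\<^sub>Q p" for p and u v :: 'a
    using scaleQ_add_left[of "u - v" v p] by (simp add: algebra_simps)
  show ?thesis
    unfolding qoperator_def Delta_op_eq_Some_iff
  proof (intro conjI allI impI, goal_cases)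
    case 1
    then show ?case using T_simps(1) by auto
  next
    case (2 u v w x)
    then obtain u' u'' v' v'' where "T u = Some u'" "T u' = Some u''" "T v = Some v'" "T v' = Some v''"
      "w = u'' - (2 * qRe q) *\<^sub>R u' + (norm q)\<^sup>2 *\<^sub>R u"
      "x = v'' - (2 * qRe q) *\<^sub>R v' + (norm q)\<^sup>2 *\<^sub>R v"
      by blast
    then show ?case
      by - (rule exI[of _ "u' + v'"], rule exI[of _ "u'' + v''"], hypsubst,
          simp add: T_simps(2) algebra_simps)
  next
    case (3 u w p)
    then obtain u' u'' where "T u = Some u'" "T u' = Some u''"
      "w = u'' - (2 * qRe q) *\<^sub>R u' + (norm q)\<^sup>2 *\<^sub>R u"
      by blast
    then show ?case
      by - (rule exI[of _ "u' *\<^sub>Q p"], rule exI[of _ "u'' *\<^sub>Q p"],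
          simp add: T_simps(4) R D scaleQ_add_left)
  qed
qed

lemma qbounded_inverse_op_iff:
  fixes T :: "'a::quat_inner \<rightharpoonup> 'a"
  assumes T: "qoperator T" and ker: "kernel T = {0}"
  shows "qbounded (inverse_op T) \<longleftrightarrow> (\<exists>C. \<forall>u v. T u = Some v \<longrightarrow> norm u \<le> C * norm v)"
proof -
  have inj: "u = u'" if "T u = Some v" "T u' = Some v" for u u' v
  proof -
    have "u - u' \<in> kernel T"
      using qoperatorD(3)[OF T that] by (simp add: kernel_def)
    then show ?thesis by (simp add: ker)
  qed
  then have "(THE u. T u = Some v) = u" if "T u = Some v" for u v
    using that by (intro the_equality) blast+
  then have "inverse_op T v = Some u \<longleftrightarrow> T u = Some v" for u v
    by (auto simp: inverse_op_def ran_def)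
  then show ?thesis
    unfolding qbounded_def by simp blast
qed

text \<open>\<open>\<Delta>\<^sub>q(T) = R\<^sub>q R\<^sub>p\<close> with \<open>p = qcnj q\<close>, where \<open>R\<^sub>p u = T u - u p\<close> is only real linear.\<close>

lemma Delta_op_bounded_below:
  fixes T :: "'a::quat_inner \<rightharpoonup> 'a"
  assumes T: "qoperator T" and "0 < k"
    and le: "\<And>u u' p. T u = Some u' \<Longrightarrow> p \<in> {q, qcnj q} \<Longrightarrow> k * norm u \<le> norm (u' - u *\<^sub>Q p)"
  shows "kernel (Delta_op q T) = {0}" and "qbounded (inverse_op (Delta_op q T))"
proof -
  have D: "(u - v) *\<^sub>Q p = u *\<^sub>Q p - v *\<^sub>Q p" for p and u v :: 'a
    using scaleQ_add_left[of "u - v" v p] by (simp add: algebra_simps)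
  have *: "norm u \<le> inverse (k\<^sup>2) * norm w" if w: "Delta_op q T u = Some w" for u w
  proof -
    obtain u' u'' where u: "T u = Some u'" "T u' = Some u''"
      "w = u'' - (2 * qRe q) *\<^sub>R u' + (norm q)\<^sup>2 *\<^sub>R u"
      using w unfolding Delta_op_eq_Some_iff by blast
    \<comment> \<open>This is \<open>R\<^sub>p u\<close>, again in D(T). The bound is used twice,
      for \<open>R\<^sub>q\<close> at this vector and for \<open>R\<^sub>p\<close> at u, which gives
      the constant \<open>k\<^sup>2\<close>.\<close>
    let ?v = "u' - u *\<^sub>Q qcnj q"
    have "T ?v = Some (u'' - u' *\<^sub>Q qcnj q)"
      using u qoperatorD[OF T] by simp
    then have "k * norm ?v \<le> norm (u'' - u' *\<^sub>Q qcnj q - ?v *\<^sub>Q q)"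
      by (intro le) auto
    moreover have "u'' - u' *\<^sub>Q qcnj q - ?v *\<^sub>Q q = w"
    proof -
      have "u' *\<^sub>Q q + u' *\<^sub>Q qcnj q = (2 * qRe q) *\<^sub>R u'"
        by (simp only: scaleR_scaleQ quat_add_qcnj flip: scaleQ_add_right)
      moreover have "u *\<^sub>Q qcnj q *\<^sub>Q q = (norm q)\<^sup>2 *\<^sub>R u"
        by (simp add: scaleQ_scaleQ quat_mult_qcnj scaleR_scaleQ of_real_def)
      ultimately show ?thesis
        by (simp add: u(3) D algebra_simps)
    qed
    moreover have "k * (k * norm u) \<le> k * norm ?v"
      using \<open>0 < k\<close> le[OF u(1), of "qcnj q"] by simp
    ultimately have "k * (k * norm u) \<le> norm w"
      by (simp only:)
    then show ?thesis
      using \<open>0 < k\<close> by (simp add: field_simps power2_eq_square)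
  qed
  have "u = 0" if "Delta_op q T u = Some 0" for u
    using *[OF that] by simp
  then show ker: "kernel (Delta_op q T) = {0}"
    using qoperatorD(1)[OF qoperator_Delta_op[OF T]] by (auto simp: kernel_def)
  show "qbounded (inverse_op (Delta_op q T))"
    using * unfolding qbounded_inverse_op_iff[OF qoperator_Delta_op[OF T] ker] by blast
qed

section \<open>Normal operators\<close>

text \<open>For w orthogonal to the range of d, \<langle>e w|e w\<rangle> = \<langle>w|d (e
  w)\<rangle> = 0 in the real product, so e w = 0.\<close>

lemma dense_range_of_formal_adjoint:
  fixes d e :: "'a::quat_hilbert \<Rightarrow> 'a"
  assumes d: "qoperator (\<lambda>u. Some (d u))" and adj: "\<And>u v. rinner (e u) v = rinner u (d v)"
    and inj: "\<And>u. e u = 0 \<Longrightarrow> u = 0"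
  shows "closure (ran (\<lambda>u. Some (d u))) = UNIV"
proof (rule dense_subspaceI[OF subspace_ran[OF d]])
  fix w assume w: "\<And>v. v \<in> ran (\<lambda>u. Some (d u)) \<Longrightarrow> rinner w v = 0"
  have "rinner (e w) (e w) = 0"
    unfolding adj by (intro w) (auto simp: ran_def)
  then show "w = 0"
    by - (rule inj, simp add: rinner_same)
qed

text \<open>The total maps d and e of the two \<Delta>-operators are formally adjoint and commute,
  so |d u| = |e u|; all three claims follow. The hypotheses are symmetric in T and S, which allows
  exchanging the roles.\<close>

lemma spectrum_eq_of_normal_pair:
  fixes T S :: "'a::quat_hilbert \<rightharpoonup> 'a"
  assumes T: "qoperator T" "\<And>u. T u = Some (t u)" and S: "qoperator S" "\<And>u. S u = Some (s u)"
    and adj: "\<And>u v. rinner (s u) v = rinner u (t v)" and commute: "\<And>u. t (s u) = s (t u)"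
  shows "kernel (Delta_op q T) = kernel (Delta_op q S)"
    and "kernel (Delta_op q T) = {0} \<Longrightarrow> closure (ran (Delta_op q T)) = UNIV"
    and "kernel (Delta_op q T) = {0} \<Longrightarrow>
      qbounded (inverse_op (Delta_op q T)) \<longleftrightarrow> qbounded (inverse_op (Delta_op q S))"
proof -
  define d where "d u = t (t u) - (2 * qRe q) *\<^sub>R t u + (norm q)\<^sup>2 *\<^sub>R u" for u
  define e where "e u = s (s u) - (2 * qRe q) *\<^sub>R s u + (norm q)\<^sup>2 *\<^sub>R u" for u
  have Dd: "Delta_op q T = (\<lambda>u. Some (d u))"
  proof
    show "Delta_op q T u = Some (d u)" for u
      by (simp add: Delta_op_eq_Some_iff T(2) d_def)
  qed
  have De: "Delta_op q S = (\<lambda>u. Some (e u))"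
  proof
    show "Delta_op q S u = Some (e u)" for u
      by (simp add: Delta_op_eq_Some_iff S(2) e_def)
  qed
  have t: "t (u + v) = t u + t v" "t (u - v) = t u - t v" "t (r *\<^sub>R u) = r *\<^sub>R t u" for u v r
    using qoperatorD(2,3,5)[OF T(1)] T(2) by (metis option.sel)+
  have s: "s (u + v) = s u + s v" "s (u - v) = s u - s v" "s (r *\<^sub>R u) = r *\<^sub>R s u" for u v r
    using qoperatorD(2,3,5)[OF S(1)] S(2) by (metis option.sel)+
  have adj_de: "rinner (e u) v = rinner u (d v)" for u v
    by (simp add: d_def e_def rinner_simps adj)
  have ed: "e (d u) = d (e u)" for u
    unfolding d_def e_def by (simp add: t s commute algebra_simps)
  have norm_eq: "norm (d u) = norm (e u)" for u
  proof -
    have "rinner (d u) (d u) = rinner (e (d u)) u"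
      by (rule adj_de[symmetric])
    also have "\<dots> = rinner u (d (e u))"
      by (simp add: ed rinner_commute)
    also have "\<dots> = rinner (e u) (e u)"
      by (rule adj_de[symmetric])
    finally show ?thesis
      by (simp add: rinner_same)
  qed
  have "d u = 0 \<longleftrightarrow> e u = 0" for u
    using norm_eq[of u] by (metis norm_eq_zero)
  then show ker: "kernel (Delta_op q T) = kernel (Delta_op q S)"
    by (simp add: kernel_def Dd De)
  assume ker0: "kernel (Delta_op q T) = {0}"
  have D: "qoperator (\<lambda>u. Some (d u))" "qoperator (\<lambda>u. Some (e u))"
    using qoperator_Delta_op[OF T(1), of q] qoperator_Delta_op[OF S(1), of q] by (simp_all add: Dd De)
  have "e u = 0 \<Longrightarrow> u = 0" for u
    using ker0 unfolding ker by (auto simp: kernel_def De)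
  then show "closure (ran (Delta_op q T)) = UNIV"
    unfolding Dd by (rule dense_range_of_formal_adjoint[OF D(1) adj_de])
  show "qbounded (inverse_op (Delta_op q T)) \<longleftrightarrow> qbounded (inverse_op (Delta_op q S))"
  proof -
    have ker1: "kernel (Delta_op q S) = {0}"
      using ker0 by (simp only: ker)
    show ?thesis
      unfolding qbounded_inverse_op_iff[OF qoperator_Delta_op[OF T(1)] ker0]
        qbounded_inverse_op_iff[OF qoperator_Delta_op[OF S(1)] ker1]
      by (simp add: Dd De norm_eq)
  qed
qed

lemma normal_op_adjoint_pair:
  fixes T :: "'a::quat_hilbert \<rightharpoonup> 'a"
  assumes "normal_op T"
  obtains t s where "qoperator T" "\<And>u. T u = Some (t u)"
    "qoperator (adjoint_op T)" "\<And>u. adjoint_op T u = Some (s u)"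
    "\<And>u v. rinner (s u) v = rinner u (t v)" "\<And>u. t (s u) = s (t u)"
proof -
  have T: "qoperator T" "dom T = UNIV" and "T \<in> \<BB>"
    and comm: "T \<circ>\<^sub>m adjoint_op T = adjoint_op T \<circ>\<^sub>m T"
    using assms by (auto simp: normal_op_def bounded_operators_def)
  have dense: "closure (dom T) = UNIV"
    by (simp add: T(2))
  define t s where "t u = the (T u)" and "s u = the (adjoint_op T u)" for u
  have t: "T u = Some (t u)" for u
    using T(2) domD[of u T] by (auto simp: t_def)
  have s: "adjoint_op T u = Some (s u)" for u
    using adjoint_op_total[OF \<open>T \<in> \<BB>\<close>] domD[of u "adjoint_op T"] by (auto simp: s_def)
  have adj: "rinner (s u) v = rinner u (t v)" for u v
    using s[of u] t[of v] unfolding adjoint_op_eq_Some_iff[OF T(1) dense] by blast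
  have comm': "t (s u) = s (t u)" for u
    using fun_cong[OF comm, of u] by (simp add: map_comp_def s t)
  show ?thesis
    using that[OF T(1) t qoperator_adjoint_op[OF T(1) dense] s adj comm'] .
qed

lemma normal_op_spectra:
  fixes T :: "'a::quat_hilbert \<rightharpoonup> 'a"
  assumes "normal_op T"
  shows "spherical_point_spectrum T = spherical_point_spectrum (adjoint_op T)"
    and "spherical_residual_spectrum T = {}"
    and "spherical_residual_spectrum (adjoint_op T) = {}"
    and "spherical_continuous_spectrum T = spherical_continuous_spectrum (adjoint_op T)"
proof -
  obtain t s where ts: "qoperator T" "\<And>u. T u = Some (t u)"
    "qoperator (adjoint_op T)" "\<And>u. adjoint_op T u = Some (s u)"
    "\<And>u v. rinner (s u) v = rinner u (t v)" "\<And>u. t (s u) = s (t u)"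
    using normal_op_adjoint_pair[OF assms] by blast
  have adj: "rinner (t u) v = rinner u (s v)" for u v
    using ts(5)[of v u] by (simp add: rinner_commute)
  note TS = spectrum_eq_of_normal_pair[OF ts]
    and ST = spectrum_eq_of_normal_pair[OF ts(3,4) ts(1,2) adj ts(6)[symmetric]]
  show "spherical_point_spectrum T = spherical_point_spectrum (adjoint_op T)"
    by (simp add: spherical_point_spectrum_def TS(1))
  show "spherical_residual_spectrum T = {}"
    unfolding spherical_residual_spectrum_def
    by (rule equals0I, elim CollectE conjE, drule TS(2), erule notE)
  show "spherical_residual_spectrum (adjoint_op T) = {}"
    unfolding spherical_residual_spectrum_def
    by (rule equals0I, elim CollectE conjE, drule ST(2), erule notE)
  show "spherical_continuous_spectrum T = spherical_continuous_spectrum (adjoint_op T)"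
    unfolding spherical_continuous_spectrum_def
  proof (rule Collect_cong, goal_cases)
    case (1 q)
    show ?case
    proof (cases "kernel (Delta_op q T) = {0}")
      case True
      moreover from this have "kernel (Delta_op q (adjoint_op T)) = {0}"
        by (simp only: TS(1))
      ultimately show ?thesis
        by (simp only: TS(2,3) ST(2))
    next
      case False
      then show ?thesis
        by (simp only: TS(1) simp_thms)
    qed
  qed
qed

text \<open>The lower bounds give the trivial kernel and the bounded inverse; the empty residual
  spectrum then gives the dense range.\<close>

lemma resolvent_setI:
  fixes T :: "'a::quat_inner \<rightharpoonup> 'a"
  assumes T: "qoperator T" and "spherical_residual_spectrum T = {}" and "0 < k"
    and "\<And>u u' p. T u = Some u' \<Longrightarrow> p \<in> {q, qcnj q} \<Longrightarrow> k * norm u \<le> norm (u' - u *\<^sub>Q p)"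
  shows "q \<notin> spherical_spectrum T"
  using Delta_op_bounded_below[OF T \<open>0 < k\<close> assms(4)] assms(2)
  by (auto simp: spherical_spectrum_def spherical_resolvent_set_def spherical_residual_spectrum_def)

text \<open>T is isometric, so the reverse triangle inequality bounds |T u - u p| below by |1 - |q||
  |u|.\<close>

lemma unitary_op_spectrum:
  fixes T :: "'a::quat_hilbert \<rightharpoonup> 'a"
  assumes "T \<in> \<BB>" "unitary_op T"
  shows "spherical_spectrum T \<subseteq> {q. norm q = 1}"
proof (rule subsetI, rule ccontr)
  fix q assume q: "q \<in> spherical_spectrum T" "q \<notin> {q. norm q = 1}"
  have "normal_op T"
    using assms unfolding unitary_op_def normal_op_def by metis
  then obtain t s where ts: "qoperator T" "\<And>u. T u = Some (t u)"
    "qoperator (adjoint_op T)" "\<And>u. adjoint_op T u = Some (s u)"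
    "\<And>u v. rinner (s u) v = rinner u (t v)" "\<And>u. t (s u) = s (t u)"
    using normal_op_adjoint_pair[OF \<open>normal_op T\<close>] by blast
  have "s (t u) = u" for u
  proof -
    have "(adjoint_op T \<circ>\<^sub>m T) u = Some u"
      using assms(2) unfolding unitary_op_def by metis
    then show ?thesis
      by (simp add: map_comp_def ts(2,4))
  qed
  then have iso: "norm (t u) = norm u" for u
    using ts(5)[of "t u" u] by (simp add: rinner_same)
  have "q \<notin> spherical_spectrum T"
  proof (rule resolvent_setI[OF ts(1) normal_op_spectra(2)[OF \<open>normal_op T\<close>]])
    show "0 < \<bar>1 - norm q\<bar>"
      using q(2) by simp
    show "\<bar>1 - norm q\<bar> * norm u \<le> norm (u' - u *\<^sub>Q p)" if "T u = Some u'" "p \<in> {q, qcnj q}" for u u' p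
    proof -
      have "norm u' = norm u" "norm (u *\<^sub>Q p) = norm u * norm q"
        using that ts(2) iso by (auto simp: norm_scaleQ)
      moreover have "\<bar>1 - norm q\<bar> * norm u = \<bar>norm u - norm u * norm q\<bar>"
        using abs_mult[of "norm u" "1 - norm q"] by (simp add: right_diff_distrib mult.commute)
      ultimately show ?thesis
        using norm_triangle_ineq3[of u' "u *\<^sub>Q p"] by simp
    qed
  qed
  with q(1) show False by blast
qed

section \<open>Self-adjoint and anti self-adjoint operators\<close>

text \<open>Both cases are treated at once as \<open>T\<^sup>* = \<epsilon> T\<close> with \<open>\<epsilon>\<^sup>2 = 1\<close>.\<close>

locale signed_self_adjoint =
  fixes T :: "'a::quat_hilbert \<rightharpoonup> 'a" and \<epsilon> :: real
  assumes T: "qoperator T" and \<epsilon>: "\<epsilon> * \<epsilon> = 1"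
    and T_iff: "T u = Some w \<longleftrightarrow> (\<forall>v v'. T v = Some v' \<longrightarrow> \<epsilon> * rinner w v = rinner u v')"
begin

lemma symmetric: "T u = Some u' \<Longrightarrow> T v = Some v' \<Longrightarrow> rinner u v' = \<epsilon> * rinner u' v"
  using T_iff by metis

text \<open>By \<open>T_iff\<close> the graph is cut out by equations that are continuous in (u, w),
  as for every adjoint.\<close>

lemma closed_graph: "closed {(u, w). T u = Some w}"
proof -
  have "{(u, w). T u = Some w} =
      (\<Inter>v. \<Inter>v'\<in>{v'. T v = Some v'}. {x. \<epsilon> * rinner (snd x) v = rinner (fst x) v'})"
  proof (rule set_eqI)
    fix x
    show "x \<in> {(u, w). T u = Some w} \<longleftrightarrow>
        x \<in> (\<Inter>v. \<Inter>v'\<in>{v'. T v = Some v'}. {x. \<epsilon> * rinner (snd x) v = rinner (fst x) v'})"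
      using T_iff[of "fst x" "snd x"] by (simp add: case_prod_beta)
  qed
  also have "closed \<dots>"
    by (intro closed_INT ballI closed_Collect_eq continuous_intros)
  finally show ?thesis .
qed

text \<open>Von Neumann's theorem that \<open>I + T\<^sup>* T\<close> is onto: project \<open>(h, 0)\<close> onto the graph of \<open>T\<close>.\<close>

lemma add_square_surj:
  obtains u u' u'' where "T u = Some u'" "T u' = Some u''" "h = u + \<epsilon> *\<^sub>R u''"
proof -
  define B where "B x y = rinner (fst x) (fst y) + rinner (snd x) (snd y)" for x y :: "'a \<times> 'a"
  let ?G = "{(u, w). T u = Some w}"
  have B: "bilinear B" "\<And>x y. B x y = B y x" "\<And>x. B x x = (norm x)\<^sup>2"
    by (auto simp: B_def bilinear_def linear_iff rinner_simps algebra_simps norm_prod_def rinner_same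
        rinner_commute)
  have G: "subspace ?G"
    using qoperatorD[OF T] by (auto simp: subspace_def zero_prod_def)
  obtain m where m: "m \<in> ?G" "\<And>v. v \<in> ?G \<Longrightarrow> B ((h, 0) - m) v = 0"
    using orthogonal_projection_exists[OF B G closed_graph, of "(h, 0)"] by blast
  obtain u u' where u: "m = (u, u')" "T u = Some u'"
    using m(1) by auto
  \<comment> \<open>Orthogonality of (h - u, -u') to the graph says that the adjoint sends u' to h -
    u.\<close>
  have "rinner (h - u) v = rinner u' v'" if "T v = Some v'" for v v'
    using m(2)[of "(v, v')"] that by (simp add: B_def u(1) rinner_simps)
  then have "T u' = Some (\<epsilon> *\<^sub>R (h - u))"
    by (subst T_iff) (simp add: rinner_simps \<epsilon> flip: mult.assoc)
  with u(2) show ?thesis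
    by (rule that) (simp add: \<epsilon>)
qed

lemma dense_range_Delta_op:
  assumes ker: "kernel (Delta_op q T) = {0}"
  shows "closure (ran (Delta_op q T)) = UNIV"
proof (rule dense_subspaceI[OF subspace_ran[OF qoperator_Delta_op[OF T]]])
  fix w assume w: "\<And>v. v \<in> ran (Delta_op q T) \<Longrightarrow> rinner w v = 0"
  define a c where "a = 2 * qRe q" and "c = (norm q)\<^sup>2"
  have Delta: "Delta_op q T u = Some (u'' - a *\<^sub>R u' + c *\<^sub>R u)"
    if "T u = Some u'" "T u' = Some u''" for u u' u''
    using that by (simp add: Delta_op_eq_Some_iff a_def c_def)
  note T_simps = qoperatorD[OF T]
  obtain z z' z'' where z: "T z = Some z'" "T z' = Some z''" "w = z + \<epsilon> *\<^sub>R z''"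
    using add_square_surj .
  text \<open>\<open>z = (I + \<epsilon> T\<^sup>2)\<^sup>-\<^sup>1 w\<close> inherits orthogonality because the inverse is symmetric and commutes
    with \<open>\<Delta>\<^sub>q(T)\<close>; unlike \<open>w\<close>, it lies in the domain of \<open>T\<^sup>2\<close>.\<close>
  have orth: "rinner z (u'' - a *\<^sub>R u' + c *\<^sub>R u) = 0" if u: "T u = Some u'" "T u' = Some u''" for u u' u''
  proof -
    obtain x x1 x2 where x: "T x = Some x1" "T x1 = Some x2" "u = x + \<epsilon> *\<^sub>R x2"
      using add_square_surj .
    \<comment> \<open>Solving for \<open>x2\<close> shows that it lies in
      \<open>D(T\<^sup>2)\<close> along with u and x, so T can be applied four times to x.\<close>
    have "\<epsilon> *\<^sub>R (u - x) = (\<epsilon> * \<epsilon>) *\<^sub>R x2"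
      by (simp only: x(3) add_diff_cancel_left' scaleR_scaleR)
    then have x2: "x2 = \<epsilon> *\<^sub>R (u - x)"
      by (simp only: \<epsilon> scaleR_one)
    define x3 x4 where "x3 = \<epsilon> *\<^sub>R (u' - x1)" and "x4 = \<epsilon> *\<^sub>R (u'' - x2)"
    have x34: "T x2 = Some x3" "T x3 = Some x4"
      using T_simps(5)[OF T_simps(3)[OF u(1) x(1)], of \<epsilon>] T_simps(5)[OF T_simps(3)[OF u(2) x(2)], of \<epsilon>]
      by (simp_all only: x3_def x4_def flip: x2)
    have u': "u' = x1 + \<epsilon> *\<^sub>R x3" "u'' = x2 + \<epsilon> *\<^sub>R x4"
      by (simp_all add: x3_def x4_def \<epsilon>)
    \<comment> \<open>Here y is \<open>\<Delta>\<^sub>q(T) x\<close>, and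
      \<open>\<Delta>\<^sub>q(T) u = (I + \<epsilon> T\<^sup>2) y\<close>. Moving
      \<open>I + \<epsilon> T\<^sup>2\<close> over to z turns the product into
      \<langle>w|y\<rangle>, with y in the range.\<close>
    define y y1 y2 where "y = x2 - a *\<^sub>R x1 + c *\<^sub>R x" and "y1 = x3 - a *\<^sub>R x2 + c *\<^sub>R x1"
      and "y2 = x4 - a *\<^sub>R x3 + c *\<^sub>R x2"
    have y: "T y = Some y1" "T y1 = Some y2"
      by (simp_all add: y_def y1_def y2_def T_simps x x34)
    have "u'' - a *\<^sub>R u' + c *\<^sub>R u = y + \<epsilon> *\<^sub>R y2"
      by (simp add: y_def y2_def u' x(3) algebra_simps)
    then have "rinner z (u'' - a *\<^sub>R u' + c *\<^sub>R u) = rinner w y"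
      using symmetric[OF z(1) y(2)] symmetric[OF z(2) y(1)] \<epsilon>
      by (simp add: z(3) rinner_simps)
    also have "\<dots> = 0"
      using Delta[OF x(1,2)] by (intro w) (auto simp: ran_def y_def)
    finally show ?thesis .
  qed
  text \<open>\<open>p\<close> is the adjoint of \<open>\<Delta>\<^sub>q(T)\<close> applied to \<open>z\<close>.\<close>
  define p where "p = z'' - (\<epsilon> * a) *\<^sub>R z' + c *\<^sub>R z"
  have "p = 0"
  proof -
    \<comment> \<open>Since p is not known to lie in \<open>D(T\<^sup>2)\<close>, it is tested
      against its own regularisation y: \<langle>p|y\<rangle> vanishes by \<open>orth\<close> and
      equals \<open>|y|\<^sup>2 + |T y|\<^sup>2\<close>.\<close>
    obtain y y1 y2 where y: "T y = Some y1" "T y1 = Some y2" "p = y + \<epsilon> *\<^sub>R y2"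
      using add_square_surj .
    have "rinner p y = rinner z (y2 - a *\<^sub>R y1 + c *\<^sub>R y)"
      using symmetric[OF z(1) y(2)] symmetric[OF z(2) y(1)] symmetric[OF z(1) y(1)] \<epsilon>
      by (simp add: p_def rinner_simps flip: mult.assoc)
    also have "\<dots> = 0"
      by (rule orth[OF y(1,2)])
    finally have "(norm y)\<^sup>2 + \<epsilon> * rinner y2 y = 0"
      by (simp add: y(3) rinner_simps rinner_same)
    moreover have "\<epsilon> * rinner y2 y = (norm y1)\<^sup>2"
      using symmetric[OF y(2,1)] by (simp add: rinner_same)
    ultimately have "y = 0" "y1 = 0"
      by (simp_all add: sum_power2_eq_zero_iff)
    then show ?thesis
      using y T_simps(1) by simp
  qed
  have cases: "\<epsilon> = 1 \<or> \<epsilon> = -1"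
    using \<epsilon> by (simp add: square_eq_1_iff)
  have "norm (z'' - a *\<^sub>R z' + c *\<^sub>R z) = norm p"
    using cases
  proof
    assume [simp]: "\<epsilon> = -1"
    \<comment> \<open>The two vectors differ only in the sign of the z' term, which is orthogonal to
      the other terms.\<close>
    have "rinner z' z = 0" "rinner z'' z' = 0"
      using symmetric[OF z(1,1)] symmetric[OF z(2,2)] by (simp_all add: rinner_commute)
    then have "rinner (z'' - a *\<^sub>R z' + c *\<^sub>R z) (z'' - a *\<^sub>R z' + c *\<^sub>R z) = rinner p p"
      by (simp add: p_def rinner_simps rinner_commute[of z' z''] rinner_commute[of z z'])
    then show ?thesis
      by (simp add: rinner_same)
  qed (simp add: p_def)
  with \<open>p = 0\<close> have "Delta_op q T z = Some 0"
    using Delta[OF z(1,2)] by simp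
  then have "z = 0"
    using ker by (auto simp: kernel_def)
  then show "w = 0"
    using z T_simps(1) by simp
qed

lemma residual_spectrum_empty: "spherical_residual_spectrum T = {}"
  using dense_range_Delta_op by (auto simp: spherical_residual_spectrum_def)

end

section \<open>Location of the spectrum\<close>

lemma self_adjoint_imp_signed:
  fixes T :: "'a::quat_hilbert \<rightharpoonup> 'a"
  assumes "qoperator T" "closure (dom T) = UNIV" "self_adjoint T"
  shows "signed_self_adjoint T 1"
proof
  show "T u = Some w \<longleftrightarrow> (\<forall>v v'. T v = Some v' \<longrightarrow> 1 * rinner w v = rinner u v')" for u w
    using assms(3) adjoint_op_eq_Some_iff[OF assms(1,2), of u w] by (simp add: self_adjoint_def)
qed (use assms in auto)

lemma anti_self_adjoint_imp_signed:
  fixes T :: "'a::quat_hilbert \<rightharpoonup> 'a"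
  assumes "qoperator T" "closure (dom T) = UNIV" "anti_self_adjoint T"
  shows "signed_self_adjoint T (-1)"
proof
  show "T u = Some w \<longleftrightarrow> (\<forall>v v'. T v = Some v' \<longrightarrow> -1 * rinner w v = rinner u v')" for u w
  proof -
    have "T u = uminus_op (adjoint_op T) u"
      using assms(3) by (simp add: anti_self_adjoint_def)
    then have "T u = Some w \<longleftrightarrow> adjoint_op T u = Some (- w)"
      by (auto simp: uminus_op_def)
    then show ?thesis
      by (simp add: adjoint_op_eq_Some_iff[OF assms(1,2)] rinner_simps)
  qed
qed (use assms in auto)

text \<open>Cauchy-Schwarz against the test vector \<open>u *\<^sub>Q v\<close>, whose norm is |u|
  |v|.\<close>

lemma norm_diff_ge_of_rinner:
  assumes "rinner (u *\<^sub>Q v) (w - u *\<^sub>Q p) = - (k * norm v * (norm u)\<^sup>2)" "v \<noteq> 0"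
  shows "k * norm u \<le> norm (w - u *\<^sub>Q p)"
proof (cases "u = 0")
  case False
  have "k * norm v * (norm u)\<^sup>2 \<le> norm u * norm v * norm (w - u *\<^sub>Q p)"
    using rinner_cauchy_schwarz[of "u *\<^sub>Q v" "w - u *\<^sub>Q p"] assms(1) by (simp add: norm_scaleQ)
  then have "(norm u * norm v) * (k * norm u) \<le> (norm u * norm v) * norm (w - u *\<^sub>Q p)"
    by (simp add: power2_eq_square mult_ac)
  then show ?thesis
    using False assms(2) by simp
qed simp

text \<open>q and \<open>qcnj q\<close> contribute equally, and their sum is 2 Re q.\<close>

lemma rinner_scaleQ_same: "rinner u (u *\<^sub>Q q) = qRe q * (norm u)\<^sup>2"
proof -
  have "2 * rinner u (u *\<^sub>Q q) = rinner u (u *\<^sub>Q (q + qcnj q))"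
    by (simp add: scaleQ_add_right rinner_simps rinner_scaleQ_right[of u u "qcnj q"] rinner_commute)
  also have "\<dots> = rinner u ((2 * qRe q) *\<^sub>R u)"
    by (simp only: quat_add_qcnj scaleR_scaleQ)
  finally show ?thesis
    by (simp add: rinner_simps rinner_same)
qed

lemma self_adjoint_spectrum:
  fixes T :: "'a::quat_hilbert \<rightharpoonup> 'a"
  assumes T: "qoperator T" "closure (dom T) = UNIV" "self_adjoint T"
  shows "spherical_spectrum T \<subseteq> \<real>"
proof (rule subsetI, rule ccontr)
  fix q assume q: "q \<in> spherical_spectrum T" "q \<notin> \<real>"
  interpret signed_self_adjoint T 1
    using T by (rule self_adjoint_imp_signed)
  have im: "norm (p - of_real (qRe p)) > 0" if "p \<in> {q, qcnj q}" for p
  proof -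
    have "q \<noteq> of_real (qRe q)"
      using q(2) Reals_of_real by metis
    with that show ?thesis
      by (auto simp: quat_eq_iff)
  qed
  have "q \<notin> spherical_spectrum T"
  proof (rule resolvent_setI[OF T(1) residual_spectrum_empty])
    show "0 < norm (q - of_real (qRe q))"
      using im by simp
    fix u u' p assume u: "T u = Some u'" and p: "p \<in> {q, qcnj q}"
    \<comment> \<open>The imaginary part of p. Symmetry of T and \<open>qcnj v = - v\<close> make
      \<langle>u v|T u\<rangle> equal to its own negative in the real product, so only the term
      \<open>u *\<^sub>Q p\<close> contributes.\<close>
    define v where "v = p - of_real (qRe p)"
    have v: "qcnj v = - v" "qRe v = 0" "norm v = norm (q - of_real (qRe q))"
      using p by (auto simp: v_def quat_eq_iff norm_quat_def)
    have "rinner (u *\<^sub>Q v) u' = rinner (u' *\<^sub>Q v) u"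
      using symmetric[OF qoperatorD(4)[OF T(1) u] u] by simp
    also have "\<dots> = - rinner (u *\<^sub>Q v) u'"
    proof -
      have "rinner (u' *\<^sub>Q v) u = rinner u' (u *\<^sub>Q qcnj v)"
        by (simp add: rinner_scaleQ_right)
      also have "u *\<^sub>Q qcnj v = - (u *\<^sub>Q v)"
        using scaleQ_add_right[of u v "- v"] scaleQ_add_right[of u 0 0] unfolding v(1)
        by (simp add: eq_neg_iff_add_eq_0 add.commute)
      finally show ?thesis
        by (simp add: rinner_simps rinner_commute)
    qed
    finally have "rinner (u *\<^sub>Q v) u' = 0" by simp
    moreover have "rinner (u *\<^sub>Q v) (u *\<^sub>Q p) = (norm v)\<^sup>2 * (norm u)\<^sup>2"
    proof -
      have "rinner (u *\<^sub>Q v) (u *\<^sub>Q p) = rinner (u *\<^sub>Q p) (u *\<^sub>Q v)"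
        by (rule rinner_commute)
      also have "\<dots> = rinner (u *\<^sub>Q (p * qcnj v)) u"
        by (simp add: rinner_scaleQ_right scaleQ_scaleQ)
      also have "\<dots> = qRe (p * qcnj v) * (norm u)\<^sup>2"
        using rinner_commute rinner_scaleQ_same by metis
      also have "qRe (p * qcnj v) = (norm v)\<^sup>2"
        unfolding norm_quat_power2 by (simp add: quat_mult_sel v_def power2_eq_square)
      finally show ?thesis .
    qed
    ultimately have "rinner (u *\<^sub>Q v) (u' - u *\<^sub>Q p) = - (norm v * norm v * (norm u)\<^sup>2)"
      by (simp add: rinner_simps power2_eq_square)
    moreover have "v \<noteq> 0"
      using im[OF p] by (simp add: v_def)
    ultimately have "norm v * norm u \<le> norm (u' - u *\<^sub>Q p)"
      by (rule norm_diff_ge_of_rinner)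
    then show "norm (q - of_real (qRe q)) * norm u \<le> norm (u' - u *\<^sub>Q p)"
      by (simp only: v(3))
  qed
  with q(1) show False by blast
qed

lemma anti_self_adjoint_spectrum:
  fixes T :: "'a::quat_hilbert \<rightharpoonup> 'a"
  assumes T: "qoperator T" "closure (dom T) = UNIV" "anti_self_adjoint T"
  shows "spherical_spectrum T \<subseteq> {q. qcnj q = - q}"
proof (rule subsetI, rule ccontr)
  fix q assume q: "q \<in> spherical_spectrum T" "q \<notin> {q. qcnj q = - q}"
  interpret signed_self_adjoint T "-1"
    using T by (rule anti_self_adjoint_imp_signed)
  have "qRe q \<noteq> 0"
    using q(2) by (auto simp: quat_eq_iff)
  have "q \<notin> spherical_spectrum T"
  proof (rule resolvent_setI[OF T(1) residual_spectrum_empty])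
    show "0 < \<bar>qRe q\<bar>"
      using \<open>qRe q \<noteq> 0\<close> by simp
    fix u u' p assume u: "T u = Some u'" and p: "p \<in> {q, qcnj q}"
    \<comment> \<open>Since Re \<langle>u|T u\<rangle> = 0, testing against u leaves -Re p |u|^2
      with Re p = Re q; the sign turns Re q into |Re q|.\<close>
    define v :: quat where "v = of_real (sgn (qRe q))"
    have "rinner u u' = 0"
      using symmetric[OF u u] by (simp add: rinner_commute)
    moreover have "u *\<^sub>Q v = sgn (qRe q) *\<^sub>R u"
      by (simp add: v_def scaleR_scaleQ)
    ultimately have "rinner (u *\<^sub>Q v) (u' - u *\<^sub>Q p) = - (\<bar>qRe q\<bar> * norm v * (norm u)\<^sup>2)"
      using p \<open>qRe q \<noteq> 0\<close>
      by (auto simp: rinner_simps rinner_scaleQ_same v_def abs_sgn mult_ac)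
    moreover have "v \<noteq> 0"
      using \<open>qRe q \<noteq> 0\<close> by (simp add: v_def sgn_eq_0_iff)
    ultimately show "\<bar>qRe q\<bar> * norm u \<le> norm (u' - u *\<^sub>Q p)"
      by (rule norm_diff_ge_of_rinner)
  qed
  with q(1) show False by blast
qed

text \<open>The two hypotheses give \<open>T\<^sup>2 = - I\<close>, and for these q the operator
  \<open>\<Delta>\<^sub>q(T)\<close> is \<open>T\<^sup>2 + I = 0\<close>; the space being nonzero,
  its kernel is nontrivial.\<close>

lemma anti_self_adjoint_unitary_point_spectrum:
  fixes T :: "'a::quat_hilbert \<rightharpoonup> 'a"
  assumes T: "anti_self_adjoint T" "unitary_op T"
  shows "{q. q\<^sup>2 = - 1} \<subseteq> spherical_point_spectrum T"
proof
  fix q :: quat assume "q \<in> {q. q\<^sup>2 = - 1}"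
  then have q: "qRe q = 0" "norm q = 1"
    by (auto simp: quat_power2_eq_minus_one_iff)
  have "Delta_op q T u = Some 0" for u
  proof -
    obtain u' where u': "T u = Some u'"
      using T(2) domD[of u T] by (auto simp: unitary_op_def)
    have "(adjoint_op T \<circ>\<^sub>m T) u = Some u"
      using T(2) by (simp add: unitary_op_def)
    then have "adjoint_op T u' = Some u"
      by (simp add: u')
    moreover have "T u' = uminus_op (adjoint_op T) u'"
      using T(1) by (simp add: anti_self_adjoint_def)
    ultimately have "T u' = Some (- u)"
      by (simp add: uminus_op_def)
    then show ?thesis
      by (simp add: Delta_op_eq_Some_iff u' q)
  qed
  moreover obtain u :: 'a where "u \<noteq> 0"
    using nonzero_space by blast
  ultimately show "q \<in> spherical_point_spectrum T"
    by (auto simp: spherical_point_spectrum_def kernel_def)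
qed

theorem theorem4p8:
  fixes T :: "'a::quat_hilbert \<rightharpoonup> 'a"
  assumes "qoperator T" and "closure (dom T) = UNIV"
  shows
    "(T \<in> \<BB> \<and> normal_op T \<longrightarrow>
        spherical_point_spectrum T = spherical_point_spectrum (adjoint_op T) \<and>
        (spherical_residual_spectrum T = spherical_residual_spectrum (adjoint_op T) \<and>
         spherical_residual_spectrum (adjoint_op T) = {}) \<and>
        spherical_continuous_spectrum T = spherical_continuous_spectrum (adjoint_op T)) \<and>
     (self_adjoint T \<longrightarrow>
        spherical_spectrum T \<subseteq> \<real> \<and> spherical_residual_spectrum T = {}) \<and>
     (anti_self_adjoint T \<longrightarrow>
        spherical_spectrum T \<subseteq> {q. qcnj q = - q} \<and> spherical_residual_spectrum T = {}) \<and>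
     (T \<in> \<BB> \<and> unitary_op T \<longrightarrow>
        spherical_spectrum T \<subseteq> {q. norm q = 1}) \<and>
     (T \<in> \<BB> \<and> anti_self_adjoint T \<and> unitary_op T \<longrightarrow>
        spherical_spectrum T = spherical_point_spectrum T \<and>
        spherical_point_spectrum T = {q. q\<^sup>2 = - 1})"
proof (intro conjI impI; (elim conjE)?)
  assume "normal_op T"
  note N = normal_op_spectra[OF this]
  show "spherical_point_spectrum T = spherical_point_spectrum (adjoint_op T)"
    "spherical_residual_spectrum T = spherical_residual_spectrum (adjoint_op T)"
    "spherical_residual_spectrum (adjoint_op T) = {}"
    "spherical_continuous_spectrum T = spherical_continuous_spectrum (adjoint_op T)"
    by (simp_all only: N)
next
  assume S: "self_adjoint T"
  show "spherical_spectrum T \<subseteq> \<real>"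
    using assms S by (rule self_adjoint_spectrum)
  show "spherical_residual_spectrum T = {}"
    using self_adjoint_imp_signed[OF assms S] by (rule signed_self_adjoint.residual_spectrum_empty)
next
  assume A: "anti_self_adjoint T"
  show "spherical_spectrum T \<subseteq> {q. qcnj q = - q}"
    using assms A by (rule anti_self_adjoint_spectrum)
  show "spherical_residual_spectrum T = {}"
    using anti_self_adjoint_imp_signed[OF assms A] by (rule signed_self_adjoint.residual_spectrum_empty)
next
  assume "T \<in> \<BB>" "unitary_op T"
  then show "spherical_spectrum T \<subseteq> {q. norm q = 1}"
    by (rule unitary_op_spectrum)
next
  assume U: "T \<in> \<BB>" "anti_self_adjoint T" "unitary_op T"
  \<comment> \<open>Imaginary quaternions of norm 1 are the square roots of -1. This closes a cycle
    of inclusions through the point spectrum.\<close>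
  have "spherical_spectrum T \<subseteq> {q. q\<^sup>2 = - 1}"
    using anti_self_adjoint_spectrum[OF assms U(2)] unitary_op_spectrum[OF U(1,3)]
    by (auto simp: quat_power2_eq_minus_one_iff quat_eq_iff[of "qcnj _"])
  moreover have "spherical_point_spectrum T \<subseteq> spherical_spectrum T"
    by (auto simp: spherical_point_spectrum_def spherical_spectrum_def spherical_resolvent_set_def)
  ultimately show "spherical_spectrum T = spherical_point_spectrum T"
    "spherical_point_spectrum T = {q. q\<^sup>2 = - 1}"
    using anti_self_adjoint_unitary_point_spectrum[OF U(2,3)] by blast+
qed

end
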